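(* Let $A\subset\mathbb{R}$, let $T:A\times\mathcal{P}(\mathbb{R})\to\mathcal{P}(\mathbb{R})$, let $F\in\mathcal{P}(\mathbb{R})$, and let $\boldsymbol{\alpha}=(\alpha_1,\ldots,\alpha_n),\boldsymbol{\beta}=(\beta_1,\ldots,\beta_n)\in A^n$. Let $(X_1,\ldots,X_n)$ be a random vector with marginal distribution functions $F_{X_i}=T(\alpha_i,F)$ and with an Archimedean copula with generator $\psi_1$, and let $(Y_1,\ldots,Y_n)$ be a random vector with marginal distribution functions $F_{Y_i}=T(\beta_i,F)$ and with an Archimedean copula with generator $\psi_2$. Let $\phi_1,\phi_2$ be the inverses of $\psi_1,\psi_2$. Assume that $T$ is differentiable with respect to its first argument, that $\phi_2\circ\psi_1$ is super-additive, that $\psi_2$ is $d$-monotone with $d\ge3$, that $\boldsymbol{\alpha}\overset{m}{\succeq}\boldsymbol{\beta}$, and that $$V(\beta)=\frac{1}{\psi_2'\circ\phi_2(T(\beta,F))}\,\frac{\partial T}{\partial\beta}(\beta,F),\qquad \beta\in A,$$ is increasing in $\beta$. Then $X_{n:n}(\boldsymbol{\alpha})\ge_{st}Y_{n:n}(\boldsymbol{\beta})$, where $X_{n:n}(\boldsymbol{\alpha})=\max\{X_1,\ldots,X_n\}$ and $Y_{n:n}(\boldsymbol{\beta})=\max\{Y_1,\ldots,Y_n\}$.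
   Context: $\mathcal{P}(\mathbb{R})$ is the set of all cumulative distribution functions on $\mathbb{R}$. The distribution functions $T(\beta,F)$, their derivatives in $\beta$, and $V(\beta)$ are functions of $x\in\mathbb{R}$, the argument $x$ being suppressed; differentiability in the first argument and monotonicity of $V$ in $\beta$ are understood pointwise in $x$. For random variables, $X\le_{st}Y$ (equivalently $Y\ge_{st}X$) means $P(X>x)\le P(Y>x)$ for every $x\in\mathbb{R}$. Majorization: $\boldsymbol{\alpha}\overset{m}{\preceq}\boldsymbol{\beta}$ (equivalently $\boldsymbol{\beta}\overset{m}{\succeq}\boldsymbol{\alpha}$) means $\sum_{i=1}^{\ell}\alpha_{i:n}\ge\sum_{i=1}^{\ell}\beta_{i:n}$ for $\ell=1,\ldots,n-1$ and $\sum_{i=1}^n\alpha_{i:n}=\sum_{i=1}^n\beta_{i:n}$, where $\alpha_{i:n},\beta_{i:n}$ are the coordinates in increasing order. A function $g$ is super-additive if $g(x+y)\ge g(x)+g(y)$ for all $x,y\ge0$. A function $f$ is $d$-monotone ($d\ge2$) on $(a,b)$ if it is differentiable up to order $d-2$ there, $(-1)^if^{(i)}\ge0$ for $i=0,\ldots,d-2$, and $(-1)^{d-2}f^{(d-2)}$ is nonincreasing and convex on $(a,b)$. A generator is a continuous $d$-monotone function $\psi:[0,\infty)\to[0,1]$ with $\psi(0)=1$ and $\lim_{x\to\infty}\psi(x)=0$; its inverse is $\phi(v)=\psi^{-1}(v)=\sup\{x:\psi(x)>v\}$. An $n$-dimensional copula $C_\psi$ is Archimedean with generator $\psi$ if $C_\psi(v_1,\ldots,v_n)=\psi(\phi(v_1)+\cdots+\phi(v_n))$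 for all $v_i\in[0,1]$. A random vector $(X_1,\ldots,X_n)$ has copula $C$ if $P(X_1\le x_1,\ldots,X_n\le x_n)=C(F_{X_1}(x_1),\ldots,F_{X_n}(x_n))$ for all $x_1,\dots,x_n\in\mathbb{R}$.
   Formalization: A is assumed to be an interval; for disconnected A the claim fails: A=(0,1)∪(2,3), T≡F1 on (0,1) and ≡F2≥F1 (F2≠F1, both positive) on (2,3), independent components, α=(.1,.1,.1,2.9), β=(.8,.8,.8,.8). V is required to be increasing only where it is defined. *)

theory Defs
  imports "HOL-Probability.Probability"
begin

definition cdfs :: "(real \<Rightarrow> real) set" where
  "cdfs = {cdf M | M. real_distribution M}"

definition random_vector :: "nat \<Rightarrow> 'a measure \<Rightarrow> (nat \<Rightarrow> 'a \<Rightarrow> real) \<Rightarrow> bool" where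
  "random_vector n M X \<longleftrightarrow> prob_space M \<and> (\<forall>i\<in>{1..n}. X i \<in> borel_measurable M)"

definition st_le :: "'a measure \<Rightarrow> ('a \<Rightarrow> real) \<Rightarrow> 'b measure \<Rightarrow> ('b \<Rightarrow> real) \<Rightarrow> bool" where
  "st_le M X N Y \<longleftrightarrow>
     (\<forall>x. measure M {\<omega> \<in> space M. X \<omega> > x} \<le> measure N {\<omega> \<in> space N. Y \<omega> > x})"

definition max_stat :: "nat \<Rightarrow> (nat \<Rightarrow> 'a \<Rightarrow> real) \<Rightarrow> 'a \<Rightarrow> real" where
  "max_stat n X \<omega> = Max ((\<lambda>i. X i \<omega>) ` {1..n})"

text \<open>The \<open>i\<close>-th smallest (\<open>1 \<le> i \<le> n\<close>) of the coordinates \<open>a 1, \<dots>, a n\<close>.\<close>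
definition incr_coord :: "nat \<Rightarrow> (nat \<Rightarrow> real) \<Rightarrow> nat \<Rightarrow> real" where
  "incr_coord n a i = sort (map a [1..<Suc n]) ! (i - 1)"

text \<open>\<open>majorizes n a b\<close>: \<open>a\<close> is the larger vector in the majorization order, so its partial sums
  of smallest coordinates are the smaller ones.\<close>
definition majorizes :: "nat \<Rightarrow> (nat \<Rightarrow> real) \<Rightarrow> (nat \<Rightarrow> real) \<Rightarrow> bool" where
  "majorizes n a b \<longleftrightarrow>
     (\<forall>l\<in>{1..n-1}. (\<Sum>i=1..l. incr_coord n b i) \<ge> (\<Sum>i=1..l. incr_coord n a i)) \<and>
     (\<Sum>i=1..n. incr_coord n b i) = (\<Sum>i=1..n. incr_coord n a i)"

text \<open>Values in \<open>[0, \<infinity>]\<close>, because the inverse of a strictly positive generator is infinite at 0.\<close>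
definition super_additive :: "(real \<Rightarrow> ennreal) \<Rightarrow> bool" where
  "super_additive g \<longleftrightarrow> (\<forall>x\<ge>0. \<forall>y\<ge>0. g (x + y) \<ge> g x + g y)"

definition d_monotone :: "nat \<Rightarrow> (real \<Rightarrow> real) \<Rightarrow> real set \<Rightarrow> bool" where
  "d_monotone d f I \<longleftrightarrow>
     d \<ge> 2 \<and>
     (\<forall>i<d-2. \<forall>x\<in>I. (deriv ^^ i) f differentiable (at x)) \<and>
     (\<forall>i\<le>d-2. \<forall>x\<in>I. (-1)^i * (deriv ^^ i) f x \<ge> 0) \<and>
     antimono_on I (\<lambda>x. (-1)^(d-2) * (deriv ^^ (d-2)) f x) \<and>
     convex_on I (\<lambda>x. (-1)^(d-2) * (deriv ^^ (d-2)) f x)"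

definition generator :: "nat \<Rightarrow> (real \<Rightarrow> real) \<Rightarrow> bool" where
  "generator d \<psi> \<longleftrightarrow>
     continuous_on {0..} \<psi> \<and> \<psi> ` {0..} \<subseteq> {0..1} \<and> d_monotone d \<psi> {0<..} \<and>
     \<psi> 0 = 1 \<and> (\<psi> \<longlongrightarrow> 0) at_top"

text \<open>The supremum is taken in \<open>[0, \<infinity>]\<close>; in particular the value at 1 is \<open>Sup {} = 0\<close>.\<close>
definition gen_inv :: "(real \<Rightarrow> real) \<Rightarrow> real \<Rightarrow> ennreal" where
  "gen_inv \<psi> v = Sup {ennreal x | x. x \<ge> 0 \<and> \<psi> x > v}"

text \<open>Extension of a generator to \<open>[0, \<infinity>]\<close> by its limit, \<open>\<psi> \<infinity> = 0\<close>.\<close>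
definition gen_ext :: "(real \<Rightarrow> real) \<Rightarrow> ennreal \<Rightarrow> real" where
  "gen_ext \<psi> t = (if t = \<infinity> then 0 else \<psi> (enn2real t))"

text \<open>An \<open>n\<close>-dimensional copula is, on the unit cube, the joint distribution function of a
  probability measure on \<open>n\<close>-space with uniform marginals.\<close>
definition copula :: "nat \<Rightarrow> ((nat \<Rightarrow> real) \<Rightarrow> real) \<Rightarrow> bool" where
  "copula n C \<longleftrightarrow>
     (\<exists>U. prob_space U \<and> sets U = sets (Pi\<^sub>M {1..n} (\<lambda>_. borel)) \<and>
        (\<forall>i\<in>{1..n}. distr U borel (\<lambda>w. w i) = uniform_measure lborel {0..1}) \<and>
        (\<forall>v. (\<forall>i\<in>{1..n}. v i \<in> {0..1}) \<longrightarrow>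
           C v = measure U {w \<in> space U. \<forall>i\<in>{1..n}. w i \<le> v i}))"

definition archimedean :: "nat \<Rightarrow> ((nat \<Rightarrow> real) \<Rightarrow> real) \<Rightarrow> (real \<Rightarrow> real) \<Rightarrow> bool" where
  "archimedean n C \<psi> \<longleftrightarrow>
     copula n C \<and>
     (\<forall>v. (\<forall>i\<in>{1..n}. v i \<in> {0..1}) \<longrightarrow> C v = gen_ext \<psi> (\<Sum>i=1..n. gen_inv \<psi> (v i)))"

definition has_copula ::
  "nat \<Rightarrow> 'a measure \<Rightarrow> (nat \<Rightarrow> 'a \<Rightarrow> real) \<Rightarrow> ((nat \<Rightarrow> real) \<Rightarrow> real) \<Rightarrow> bool" where
  "has_copula n M X C \<longleftrightarrow>
     (\<forall>x. measure M {\<omega> \<in> space M. \<forall>i\<in>{1..n}. X i \<omega> \<le> x i} =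
          C (\<lambda>i. cdf (distr M borel (X i)) (x i)))"

text \<open>\<open>V\<close> at parameter \<open>b\<close> and argument \<open>x\<close>. Derivatives are one-sided at endpoints:
  that of \<open>\<psi>\<close> at 0 is the right derivative, that of \<open>T\<close> is taken within \<open>A\<close>.\<close>
definition V_fun ::
  "real set \<Rightarrow> (real \<Rightarrow> (real \<Rightarrow> real) \<Rightarrow> real \<Rightarrow> real) \<Rightarrow> (real \<Rightarrow> real) \<Rightarrow> (real \<Rightarrow> real) \<Rightarrow>
   real \<Rightarrow> real \<Rightarrow> real" where
  "V_fun A T F \<psi> b x =
     1 / vector_derivative \<psi> (at (enn2real (gen_inv \<psi> (T b F x))) within {0..})
     * vector_derivative (\<lambda>c. T c F x) (at b within A)"

text \<open>The parameters at which the quotient defining \<open>V\<close> is meaningful at \<open>x\<close>: \<open>gen_inv\<close> is finite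
  and \<open>\<psi>\<close> has a finite nonzero derivative there. For a \<open>d\<close>-monotone generator with \<open>d \<ge> 3\<close> this always
  holds when \<open>0 < T b F x < 1\<close>, and never when \<open>T b F x = 0\<close>, where the quotient is \<open>0/0\<close> or \<open>gen_inv\<close> is infinite. It prevents the
  convention \<open>1/0 = 0\<close> from contributing spurious values of \<open>V\<close>.\<close>
definition V_domain ::
  "real set \<Rightarrow> (real \<Rightarrow> (real \<Rightarrow> real) \<Rightarrow> real \<Rightarrow> real) \<Rightarrow> (real \<Rightarrow> real) \<Rightarrow> (real \<Rightarrow> real) \<Rightarrow>
   real \<Rightarrow> real set" where
  "V_domain A T F \<psi> x =
     {b \<in> A. gen_inv \<psi> (T b F x) < \<infinity> \<and>
        (\<exists>D. D \<noteq> 0 \<and>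
          (\<psi> has_real_derivative D) (at (enn2real (gen_inv \<psi> (T b F x))) within {0..}))}"

end

theory Submission
  imports Defs
begin

text \<open>
  Fix \<open>x\<close> and write \<open>t b = T b F x\<close>, so that the two probabilities \<open>P (max \<le> x)\<close> to be compared are
  \<open>\<psi>\<^sub>1 (\<Sum>i. \<phi>\<^sub>1 (t (\<alpha> i)))\<close> and \<open>\<psi>\<^sub>2 (\<Sum>i. \<phi>\<^sub>2 (t (\<beta> i)))\<close>. If some \<open>t (\<alpha> i)\<close> is 0, the first one vanishes.
  Otherwise super-additivity bounds it by \<open>\<psi>\<^sub>2 (\<Sum>i. \<phi>\<^sub>2 (t (\<alpha> i)))\<close>. As \<open>V\<close> is the derivative of \<open>\<phi>\<^sub>2 \<circ> t\<close>
  where \<open>0 < t < 1\<close>, its monotonicity makes \<open>\<phi>\<^sub>2 \<circ> t\<close> convex on the convex hull of the \<open>\<alpha> i\<close>, and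
  Karamata's inequality allows passing from \<open>\<alpha>\<close> to \<open>\<beta>\<close>. Points with \<open>t = 1\<close>, where \<open>V\<close> may be undefined,
  do no harm: \<open>\<phi>\<^sub>2 \<circ> t\<close> vanishes there, and a nonnegative function can only exceed one of its chords
  where it is positive.
\<close>

subsection \<open>Convexity and crossings\<close>

text \<open>The point \<open>y\<close> is the maximum of the compact set where
  \<open>g x \<le> c\<close>. If \<open>g y < c\<close>, the intermediate value theorem would give
  the value \<open>c\<close> again to the right of \<open>y\<close>.\<close>

lemma last_crossing:
  fixes g :: "real \<Rightarrow> real"
  assumes "continuous_on {a..b} g" "a \<le> b" "g a \<le> c" "c < g b"
  obtains y where "a \<le> y" "y < b" "g y = c" "\<And>x. y < x \<Longrightarrow> x \<le> b \<Longrightarrow> c < g x"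
proof -
  let ?S = "{x \<in> {a..b}. g x \<le> c}"
  have "closedin (top_of_set {a..b}) ({a..b} \<inter> g -` {..c})"
    by (rule continuous_closedin_preimage[OF assms(1)]) simp
  then have "compact ({a..b} \<inter> g -` {..c})"
    using closedin_compact compact_Icc by blast
  moreover have "{a..b} \<inter> g -` {..c} = ?S" by auto
  ultimately have "compact ?S" by simp
  moreover have "?S \<noteq> {}" using assms by auto
  ultimately obtain y where y: "y \<in> ?S" "\<And>x. x \<in> ?S \<Longrightarrow> x \<le> y"
    using compact_attains_sup[of ?S] by blast
  have "y < b" using y assms by (cases "y = b") auto
  moreover have *: "c < g x" if "y < x" "x \<le> b" for x
    using y(2)[of x] y(1) that by (cases "g x \<le> c") auto
  moreover have "g y = c"
  proof (rule ccontr)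
    assume "g y \<noteq> c"
    then have "g y < c" using y by auto
    moreover have "continuous_on {y..b} g"
      using assms(1) y by (auto intro: continuous_on_subset)
    ultimately obtain x where "y \<le> x" "x \<le> b" "g x = c"
      using IVT'[of g y c b] \<open>y < b\<close> assms by auto
    then show False using *[of x] \<open>g y < c\<close> by (cases "x = y") auto
  qed
  ultimately show ?thesis using that y by auto
qed

text \<open>This is \<open>last_crossing\<close> reflected in the origin.\<close>

lemma first_crossing:
  fixes g :: "real \<Rightarrow> real"
  assumes "continuous_on {a..b} g" "a \<le> b" "c < g a" "g b \<le> c"
  obtains y where "a < y" "y \<le> b" "g y = c" "\<And>x. a \<le> x \<Longrightarrow> x < y \<Longrightarrow> c < g x"
proof -
  have "continuous_on {-b..-a} (\<lambda>x. g (-x))"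
    by (intro continuous_on_compose2[OF assms(1)] continuous_intros) auto
  then obtain y where y: "-b \<le> y" "y < -a" "g (-y) = c"
      "\<And>x. y < x \<Longrightarrow> x \<le> -a \<Longrightarrow> c < g (-x)"
    using last_crossing[of "-b" "-a" "\<lambda>x. g (-x)" c] assms by auto
  show ?thesis using that[of "-y"] y(1-3) y(4)[of "-x" for x] by simp
qed

text \<open>If \<open>h\<close> lay above a chord at \<open>m\<close>, there would be an interval
  around \<open>m\<close> inside which \<open>h\<close> exceeds the chord and at whose ends they
  agree. The chord is nonnegative, so \<open>h\<close> is positive and differentiable inside, and
  the mean value theorem gives a slope above that of the chord, then one below it, against the
  monotonicity of \<open>V\<close>.\<close>

lemma convex_on_Icc_if_deriv_mono_where_pos:
  fixes h V :: "real \<Rightarrow> real"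
  assumes cont: "continuous_on {a..b} h"
    and nonneg: "\<And>x. x \<in> {a..b} \<Longrightarrow> h x \<ge> 0"
    and deriv: "\<And>x. a < x \<Longrightarrow> x < b \<Longrightarrow> h x > 0 \<Longrightarrow> (h has_real_derivative V x) (at x)"
    and mono: "\<And>x y. a < x \<Longrightarrow> x < y \<Longrightarrow> y < b \<Longrightarrow> h x > 0 \<Longrightarrow> h y > 0 \<Longrightarrow> V x \<le> V y"
  shows "convex_on {a..b} h"
proof
  fix s p q :: real
  assume s: "0 < s" "s < 1" and pq: "p \<in> {a..b}" "q \<in> {a..b}" "p < q"
  define m where "m = (1 - s) * p + s * q"
  define k where "k = (h q - h p) / (q - p)"
  define L where "L x = h p + k * (x - p)" for x
  have "m = p + s * (q - p)" by (simp add: m_def algebra_simps)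
  moreover have "0 < s * (q - p)" "s * (q - p) < q - p" using s pq by auto
  ultimately have pm: "p < m" "m < q" by auto
  have Lq: "L q = h q" and Lp: "L p = h p" using pq by (auto simp: L_def k_def)
  have Lm: "L m = (1 - s) * h p + s * h q"
    using pq by (simp add: L_def k_def m_def field_simps)
  have Lpos: "L x \<ge> 0" if "p \<le> x" "x \<le> q" for x
  proof -
    have "L x = ((q - x) * h p + (x - p) * h q) / (q - p)"
      using pq by (simp add: L_def k_def field_simps)
    then show ?thesis using that pq nonneg by auto
  qed
  have "h m \<le> L m"
  proof (rule ccontr)
    assume above: "\<not> h m \<le> L m"
    have c: "continuous_on {p..m} (\<lambda>x. h x - L x)" "continuous_on {m..q} (\<lambda>x. h x - L x)"
      unfolding L_def using pq pm
      by (intro continuous_intros continuous_on_subset[OF cont]; simp)+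
    \<comment> \<open>Together with \<open>v\<close> below, this gives the largest open interval
      around \<open>m\<close> on which \<open>h\<close> stays above \<open>L\<close>.\<close>
    obtain u where u: "p \<le> u" "u < m" "h u - L u = 0"
        "\<And>x. u < x \<Longrightarrow> x \<le> m \<Longrightarrow> 0 < h x - L x"
      using last_crossing[OF c(1), of 0] pm above Lp by auto
    obtain v where v: "m < v" "v \<le> q" "h v - L v = 0"
        "\<And>x. m \<le> x \<Longrightarrow> x < v \<Longrightarrow> 0 < h x - L x"
      using first_crossing[OF c(2), of 0] pm above Lq by auto
    have pos: "h x > 0" if "u < x" "x < v" for x
      using Lpos[of x] u(1) u(4)[of x] v(2) v(4)[of x] that by fastforce
    have d: "(h has_real_derivative V x) (at x)" if "u < x" "x < v" for x
      using deriv[of x] pos[of x] that u v pq by auto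
    then have diff: "h differentiable (at x)" if "u < x" "x < v" for x
      using real_differentiable_def that by blast
    have cc: "continuous_on {u..m} h" "continuous_on {m..v} h"
      using cont u v pm pq by (auto intro: continuous_on_subset)
    obtain l1 z1 where z1: "u < z1" "z1 < m" "DERIV h z1 :> l1" "h m - h u = (m - u) * l1"
      using MVT[OF u(2) cc(1) diff] v(1) by auto
    obtain l2 z2 where z2: "m < z2" "z2 < v" "DERIV h z2 :> l2" "h v - h m = (v - m) * l2"
      using MVT[OF v(1) cc(2) diff] u(2) by auto
    have "l1 = V z1" "l2 = V z2"
      using DERIV_unique[OF z1(3) d[of z1]] DERIV_unique[OF z2(3) d[of z2]] z1 z2 u(2) v(1)
      by auto
    moreover have "V z1 \<le> V z2" using mono[of z1 z2] pos z1 z2 u v pq by auto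
    ultimately have "l1 \<le> l2" by simp
    moreover have "(m - u) * k < (m - u) * l1"
    proof -
      have "L m - L u = (m - u) * k" by (simp add: L_def algebra_simps)
      then show ?thesis using z1(4) u(3) above by linarith
    qed
    moreover have "(v - m) * l2 < (v - m) * k"
    proof -
      have "L v - L m = (v - m) * k" by (simp add: L_def algebra_simps)
      then show ?thesis using z2(4) v(3) above by linarith
    qed
    ultimately show False using u v by auto
  qed
  then show "h ((1 - s) *\<^sub>R p + s *\<^sub>R q) \<le> (1 - s) * h p + s * h q"
    by (simp add: Lm flip: m_def)
qed simp

text \<open>The mean value theorem on the whole interval might return a point with
  \<open>t x \<ge> 1\<close>, where \<open>V\<close> need not be defined. It is applied instead
  between the last passage through a level \<open>c < 1\<close> and the first zero
  \<open>z\<close>.\<close>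

lemma decreasing_point_before_zero:
  fixes t :: "real \<Rightarrow> real"
  assumes cont: "continuous_on {a..b} t" and "a \<le> b" "0 < t a" "t b = 0"
    and diff: "\<And>x. a < x \<Longrightarrow> x < b \<Longrightarrow> t differentiable (at x)"
  obtains x D where "a < x" "x < b" "0 < t x" "t x < 1" "(t has_real_derivative D) (at x)" "D < 0"
proof -
  obtain z where z: "a < z" "z \<le> b" "t z = 0" "\<And>x. a \<le> x \<Longrightarrow> x < z \<Longrightarrow> 0 < t x"
    using first_crossing[OF cont, of 0] assms by auto
  \<comment> \<open>The bound \<open>t a\<close> ensures that the level is attained, the bound 1/2
    that it lies below 1.\<close>
  define c where "c = min (t a) (1/2)"
  have c: "0 < c" "c < 1" "c \<le> t a" using assms by (auto simp: c_def)
  have "continuous_on {a..z} (\<lambda>x. - t x)"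
    using z by (intro continuous_intros continuous_on_subset[OF cont]) auto
  then obtain y where y: "a \<le> y" "y < z" "- t y = - c" "\<And>x. y < x \<Longrightarrow> x \<le> z \<Longrightarrow> - c < - t x"
    using last_crossing[of a z "\<lambda>x. - t x" "- c"] z c by auto
  have "continuous_on {y..z} t" using y z by (auto intro: continuous_on_subset[OF cont])
  then obtain l x where x: "y < x" "x < z" "DERIV t x :> l" "t z - t y = (z - y) * l"
    using MVT[of y z t] diff y(1,2) z(2) by (smt (verit))
  have "(z - y) * l < 0" using x z y c by simp
  then have "l < 0" using y by (simp add: mult_less_0_iff)
  moreover have "0 < t x" "t x < 1" using z(4)[of x] y(1,3) y(4)[of x] x(1,2) c by auto
  ultimately show ?thesis using that[of x l] x y z by auto
qed

text \<open>Reflection turns an increase after the zero into a decrease before it.\<close>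

lemma increasing_point_after_zero:
  fixes t :: "real \<Rightarrow> real"
  assumes cont: "continuous_on {a..b} t" and "a \<le> b" "t a = 0" "0 < t b"
    and diff: "\<And>x. a < x \<Longrightarrow> x < b \<Longrightarrow> t differentiable (at x)"
  obtains x D where "a < x" "x < b" "0 < t x" "t x < 1" "(t has_real_derivative D) (at x)" "D > 0"
proof -
  have "continuous_on {-b..-a} (\<lambda>x. t (-x))"
    by (intro continuous_on_compose2[OF cont] continuous_intros) auto
  moreover have "(\<lambda>x. t (-x)) differentiable (at x)" if "-b < x" "x < -a" for x
  proof -
    have "t differentiable (at (-x))" using diff[of "-x"] that by simp
    then obtain D where "(t has_real_derivative D) (at (-x))"
      unfolding real_differentiable_def by blast
    then show ?thesis unfolding DERIV_mirror real_differentiable_def by blast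
  qed
  ultimately obtain x D where x: "-b < x" "x < -a" "0 < t (-x)" "t (-x) < 1"
      "((\<lambda>x. t (-x)) has_real_derivative D) (at x)" "D < 0"
    using decreasing_point_before_zero[of "-b" "-a" "\<lambda>x. t (-x)"] assms by auto
  from x(5) have "(t has_real_derivative - D) (at (-x))" unfolding DERIV_mirror by simp
  then show ?thesis using that[of "-x" "-D"] x by simp
qed

subsection \<open>Karamata's inequality\<close>

text \<open>A chord slope of a convex function grows when either endpoint moves right; two ordered
  pairs are compared through the mixed slope \<open>S u v'\<close>. Slopes are symmetric in their
  endpoints, so each pair may be ordered by \<open>min\<close> and \<open>max\<close>.\<close>

lemma convex_on_slope_mono:
  fixes h :: "real \<Rightarrow> real"
  assumes h: "convex_on I h" and "p \<in> I" "q \<in> I" "p' \<in> I" "q' \<in> I"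
    and "p \<le> p'" "q \<le> q'" "p \<noteq> q" "p' \<noteq> q'"
  shows "(h p - h q) / (p - q) \<le> (h p' - h q') / (p' - q')"
proof -
  define S where "S x y = (h x - h y) / (x - y)" for x y
  have sym: "S x y = S y x" for x y
    unfolding S_def by (metis minus_diff_eq minus_divide_divide)
  have right: "S x y \<le> S x z" if "x \<in> I" "z \<in> I" "x < y" "y \<le> z" for x y z
    using convex_on_slope_le(1)[OF h, of x z y] that by (cases "y = z") (auto simp: S_def)
  have left: "S x z \<le> S y z" if "x \<in> I" "z \<in> I" "x \<le> y" "y < z" for x y z
    using convex_on_slope_le(2)[OF h, of x z y] that by (cases "x = y") (auto simp: S_def)
  have ordered: "S u v \<le> S u' v'"
    if "u \<in> I" "v \<in> I" "u' \<in> I" "v' \<in> I" "u \<le> u'" "v \<le> v'" "u < v" "u' < v'" for u v u' v'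
    using right[of u v' v] left[of u v' u'] that by auto
  have "S (min p q) (max p q) \<le> S (min p' q') (max p' q')"
    by (rule ordered) (use assms in \<open>auto simp: min_def max_def\<close>)
  moreover have "S (min x y) (max x y) = S x y" for x y
    by (auto simp: min_def max_def sym)
  ultimately show ?thesis by (simp add: S_def)
qed

text \<open>Each \<open>h (a i) - h (b i)\<close> is a slope \<open>c i\<close> times
  \<open>a i - b i\<close>. The slopes increase since both vectors are sorted, while the partial
  sums of \<open>a i - b i\<close> are nonpositive and end at 0.\<close>

lemma karamata_sorted:
  fixes h :: "real \<Rightarrow> real" and a b :: "nat \<Rightarrow> real"
  assumes h: "convex_on I h"
    and mem: "\<And>i. i < n \<Longrightarrow> a i \<in> I \<and> b i \<in> I"
    and sorted: "\<And>i j. i \<le> j \<Longrightarrow> j < n \<Longrightarrow> a i \<le> a j \<and> b i \<le> b j"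
    and partial: "\<And>l. l < n \<Longrightarrow> (\<Sum>i<l. a i) \<le> (\<Sum>i<l. b i)"
    and total: "(\<Sum>i<n. a i) = (\<Sum>i<n. b i)"
  shows "(\<Sum>i<n. h (b i)) \<le> (\<Sum>i<n. h (a i))"
proof -
  define c where "c i = (h (a i) - h (b i)) / (a i - b i)" for i :: nat
  have c_mono: "c i \<le> c j" if "i \<le> j" "j < n" "a i \<noteq> b i" "a j \<noteq> b j" for i j
    unfolding c_def using convex_on_slope_mono[OF h] mem sorted that by simp
  have partial': "(\<Sum>i<l. a i - b i) \<le> 0" if "l \<le> n" for l
    using partial[of l] total that by (cases "l = n") (auto simp: sum_subtractf)
  txt \<open>Abel summation with the increasing slopes \<open>c i\<close>; indices with \<open>a i = b i\<close> have no slope, so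
    the induction hypothesis quantifies over all bounds \<open>k\<close> of the slopes seen so far.\<close>
  have "k * (\<Sum>i<m. a i - b i) \<le> (\<Sum>i<m. h (a i) - h (b i))"
    if "m \<le> n" "\<And>i. i < m \<Longrightarrow> a i \<noteq> b i \<Longrightarrow> c i \<le> k" for m k
    using that
  proof (induction m arbitrary: k)
    case (Suc m)
    show ?case
    proof (cases "a m = b m")
      case True
      then show ?thesis using Suc.IH[of k] Suc.prems by auto
    next
      case False
      \<comment> \<open>The partial sum is nonpositive, so replacing \<open>k\<close> by the smaller
        \<open>c m\<close> can only increase the product.\<close>
      have "k * (\<Sum>i<Suc m. a i - b i) \<le> c m * (\<Sum>i<Suc m. a i - b i)"
        using Suc.prems(2)[of m] partial'[OF Suc.prems(1)] False
        by (intro mult_right_mono_neg) auto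
      also have "\<dots> = c m * (\<Sum>i<m. a i - b i) + (h (a m) - h (b m))"
        using False by (simp add: c_def distrib_left del: sum_subtractf)
      also have "\<dots> \<le> (\<Sum>i<Suc m. h (a i) - h (b i))"
        using Suc.IH[of "c m"] Suc.prems(1) c_mono False by auto
      finally show ?thesis .
    qed
  qed simp
  \<comment> \<open>Any upper bound of the slopes would do, as it multiplies a total that is
    0.\<close>
  from this[of n "Max (c ` {..<n})"]
  have "Max (c ` {..<n}) * (\<Sum>i<n. a i - b i) \<le> (\<Sum>i<n. h (a i) - h (b i))" by simp
  then show ?thesis using total by (simp add: sum_subtractf)
qed

section \<open>Ordered coordinates and majorization\<close>

lemma sum_incr_coord:
  "(\<Sum>i<n. f (incr_coord n a (Suc i))) = (\<Sum>i=1..n. f (a i))"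
proof -
  have "(\<Sum>i<n. f (incr_coord n a (Suc i))) = sum_list (map f (sort (map a [1..<Suc n])))"
    by (simp add: incr_coord_def sum_list_sum_nth atLeast0LessThan del: upt_Suc)
  also have "\<dots> = sum_mset (image_mset f (mset (map a [1..<Suc n])))"
    by (simp flip: sum_mset_sum_list del: upt_Suc)
  also have "\<dots> = sum_list (map (\<lambda>i. f (a i)) [1..<Suc n])"
    by (simp flip: sum_mset_sum_list del: upt_Suc add: multiset.map_comp comp_def)
  also have "\<dots> = (\<Sum>i=1..n. f (a i))"
    by (simp only: interv_sum_list_conv_sum_set_nat set_upt atLeastLessThanSuc_atLeastAtMost)
  finally show ?thesis .
qed

lemma incr_coord_mono:
  assumes "i \<le> j" "j < n"
  shows "incr_coord n a (Suc i) \<le> incr_coord n a (Suc j)"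
  unfolding incr_coord_def using assms by (auto intro!: sorted_nth_mono simp del: upt_Suc)

lemma incr_coord_in_image:
  assumes "i < n"
  shows "incr_coord n a (Suc i) \<in> a ` {1..n}"
proof -
  have "incr_coord n a (Suc i) \<in> set (sort (map a [1..<Suc n]))"
    unfolding incr_coord_def using assms by (intro nth_mem) (simp del: upt_Suc)
  then show ?thesis by (auto simp del: upt_Suc simp: less_Suc_eq_le)
qed

lemma coord_is_incr_coord:
  assumes "i \<in> {1..n}"
  obtains j where "j < n" "a i = incr_coord n a (Suc j)"
proof -
  have "a i \<in> set (sort (map a [1..<Suc n]))" using assms by (simp del: upt_Suc)
  then obtain j where "j < n" "sort (map a [1..<Suc n]) ! j = a i"
    unfolding in_set_conv_nth by (auto simp del: upt_Suc)
  then show ?thesis using that[of j] by (simp add: incr_coord_def del: upt_Suc)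
qed

text \<open>The first partial sum compares the smallest coordinates; the partial sum of length
  \<open>n - 1\<close>, subtracted from the common total, compares the largest.\<close>

lemma majorizes_hull:
  assumes maj: "majorizes n \<alpha> \<beta>" and j: "j < n"
  shows "incr_coord n \<beta> (Suc j) \<in> {incr_coord n \<alpha> 1..incr_coord n \<alpha> n}"
proof -
  define a b where "a i = incr_coord n \<alpha> (Suc i)" and "b i = incr_coord n \<beta> (Suc i)" for i
  have part: "(\<Sum>i<l. a i) \<le> (\<Sum>i<l. b i)" if "l < n" for l
    using maj that unfolding majorizes_def a_def b_def
    by (cases "l = 0") (auto simp: sum.atLeast1_atMost_eq)
  have tot: "(\<Sum>i<n. a i) = (\<Sum>i<n. b i)"
    using maj unfolding majorizes_def a_def b_def by (simp add: sum.atLeast1_atMost_eq)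
  obtain m where m: "n = Suc m" using j by (cases n) auto
  have "a 0 \<le> b 0" using part[of 1] tot m by (cases m) auto
  moreover have "b m \<le> a m" using part[of m] tot m by auto
  moreover have "b 0 \<le> b j" "b j \<le> b m"
    unfolding b_def using j m by (auto intro: incr_coord_mono)
  ultimately show ?thesis unfolding a_def b_def m by simp
qed

text \<open>Convexity on the hull of the \<open>\<alpha> i\<close> suffices because majorization
  confines the \<open>\<beta> i\<close> to it.\<close>

lemma karamata_majorizes:
  fixes h :: "real \<Rightarrow> real"
  assumes maj: "majorizes n \<alpha> \<beta>" and h: "convex_on {incr_coord n \<alpha> 1..incr_coord n \<alpha> n} h"
  shows "(\<Sum>i=1..n. h (\<beta> i)) \<le> (\<Sum>i=1..n. h (\<alpha> i))"
proof -
  have "(\<Sum>i<n. h (incr_coord n \<beta> (Suc i))) \<le> (\<Sum>i<n. h (incr_coord n \<alpha> (Suc i)))"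
  proof (rule karamata_sorted[OF h])
    fix i assume i: "i < n"
    have "incr_coord n \<alpha> (Suc 0) \<le> incr_coord n \<alpha> (Suc i)"
      "incr_coord n \<alpha> (Suc i) \<le> incr_coord n \<alpha> (Suc (n - 1))"
      using i by (intro incr_coord_mono; simp)+
    then show "incr_coord n \<alpha> (Suc i) \<in> {incr_coord n \<alpha> 1..incr_coord n \<alpha> n}
        \<and> incr_coord n \<beta> (Suc i) \<in> {incr_coord n \<alpha> 1..incr_coord n \<alpha> n}"
      using majorizes_hull[OF maj i] i by simp
  next
    fix l assume "l < n"
    then show "(\<Sum>i<l. incr_coord n \<alpha> (Suc i)) \<le> (\<Sum>i<l. incr_coord n \<beta> (Suc i))"
      using maj unfolding majorizes_def
      by (cases "l = 0") (auto simp: sum.atLeast1_atMost_eq)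
  qed (use maj in \<open>auto simp: majorizes_def sum.atLeast1_atMost_eq intro: incr_coord_mono\<close>)
  then show ?thesis by (simp add: sum_incr_coord)
qed

subsection \<open>Generators and their inverses\<close>

text \<open>The limit at infinity makes the supremum a real number \<open>s\<close>. By continuity,
  \<open>\<psi> s > u\<close> would persist to the right of \<open>s\<close> and
  \<open>\<psi> s < u\<close> to the left, each contradicting the choice of \<open>s\<close>. The
  lemma is stated in this form to serve \<open>\<psi>\<^sub>1\<close> too, whose order
  \<open>d\<^sub>1\<close> may be 2.\<close>

lemma gen_inv_attained:
  assumes cont: "continuous_on {0..} \<psi>" and one: "\<psi> 0 = 1" and lim: "(\<psi> \<longlongrightarrow> 0) at_top"
    and u: "0 < u" "u \<le> 1"
  obtains s where "0 \<le> s" "gen_inv \<psi> u = ennreal s" "\<psi> s = u"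
proof -
  let ?S = "{ennreal x | x. x \<ge> 0 \<and> \<psi> x > u}"
  obtain K where K: "\<And>x. x \<ge> K \<Longrightarrow> \<psi> x < u"
    using order_tendstoD(2)[OF lim u(1)] unfolding eventually_at_top_linorder by blast
  have "gen_inv \<psi> u \<le> ennreal K"
    unfolding gen_inv_def
  proof (rule Sup_least, safe)
    fix x assume "0 \<le> x" "u < \<psi> x"
    then have "x \<le> K" using K[of x] by (cases "x \<le> K") auto
    then show "ennreal x \<le> ennreal K" by (rule ennreal_leI)
  qed
  then have "gen_inv \<psi> u < \<infinity>" by (simp add: less_top order_le_less_trans)
  then obtain s where s: "0 \<le> s" "gen_inv \<psi> u = ennreal s"
    by (cases "gen_inv \<psi> u") auto
  have upper: "x \<le> s" if "0 \<le> x" "u < \<psi> x" for x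
  proof -
    have "ennreal x \<le> gen_inv \<psi> u"
      unfolding gen_inv_def using that by (intro Sup_upper) blast
    then show ?thesis using s that by (simp add: ennreal_le_iff)
  qed
  have near: "\<exists>e>0. \<forall>x\<ge>0. \<bar>x - s\<bar> < e \<longrightarrow> \<bar>\<psi> x - \<psi> s\<bar> < r" if "r > 0" for r
    using cont s(1) that unfolding continuous_on_iff dist_real_def by (metis atLeast_iff)
  have "\<psi> s \<le> u"
  proof (rule ccontr)
    assume "\<not> \<psi> s \<le> u"
    then obtain e where e: "e > 0" "\<And>x. x \<ge> 0 \<Longrightarrow> \<bar>x - s\<bar> < e \<Longrightarrow> \<bar>\<psi> x - \<psi> s\<bar> < \<psi> s - u"
      using near[of "\<psi> s - u"] by auto
    have "u < \<psi> (s + e / 2)" using e(2)[of "s + e / 2"] e(1) s(1) by simp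
    then show False using upper[of "s + e / 2"] e(1) s(1) by simp
  qed
  moreover have "u \<le> \<psi> s"
  proof (cases "s = 0")
    case False
    show ?thesis
    proof (rule ccontr)
      assume "\<not> u \<le> \<psi> s"
      then obtain e where e: "e > 0" "\<And>x. x \<ge> 0 \<Longrightarrow> \<bar>x - s\<bar> < e \<Longrightarrow> \<bar>\<psi> x - \<psi> s\<bar> < u - \<psi> s"
        using near[of "u - \<psi> s"] by auto
      \<comment> \<open>A smaller upper bound of the set, cut off at 0 because \<open>\<psi>\<close>
        is controlled only on \<open>{0..}\<close>.\<close>
      define r where "r = max 0 (s - e / 2)"
      have r: "0 \<le> r" "r < s" "s - e < r" using e(1) s(1) False by (auto simp: r_def)
      have "gen_inv \<psi> u \<le> ennreal r"
        unfolding gen_inv_def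
      proof (rule Sup_least, safe)
        fix x assume x: "0 \<le> x" "u < \<psi> x"
        have "x \<le> r"
          using upper[OF x] e(2)[of x] x r by (cases "x \<le> r") auto
        then show "ennreal x \<le> ennreal r" by (rule ennreal_leI)
      qed
      then show False using s r by (simp add: ennreal_le_iff)
    qed
  qed (use one u in simp)
  ultimately show ?thesis using that[of s] s by auto
qed

context
  fixes d :: nat and \<psi> :: "real \<Rightarrow> real"
  assumes gen: "generator d \<psi>" and d: "d \<ge> 3"
begin

lemma generator_cont: "continuous_on {0..} \<psi>"
  and generator_range: "0 \<le> x \<Longrightarrow> 0 \<le> \<psi> x" "0 \<le> x \<Longrightarrow> \<psi> x \<le> 1"
  and generator_zero: "\<psi> 0 = 1"
  and generator_lim: "(\<psi> \<longlongrightarrow> 0) at_top"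
  using gen unfolding generator_def by auto

lemma generator_d_monotone:
  "i < d - 2 \<Longrightarrow> 0 < x \<Longrightarrow> (deriv ^^ i) \<psi> differentiable (at x)"
  "i \<le> d - 2 \<Longrightarrow> 0 < x \<Longrightarrow> (-1)^i * (deriv ^^ i) \<psi> x \<ge> 0"
  using gen unfolding generator_def d_monotone_def by blast+

lemma generator_has_deriv:
  assumes "x > 0"
  shows "(\<psi> has_real_derivative deriv \<psi> x) (at x)"
proof -
  have "(deriv ^^ 0) \<psi> differentiable (at x)"
    using generator_d_monotone(1)[of 0 x] d assms by simp
  then show ?thesis
    by (simp add: DERIV_deriv_iff_real_differentiable)
qed

lemma generator_deriv_nonpos:
  assumes "x > 0"
  shows "deriv \<psi> x \<le> 0"
proof -
  have "1 \<le> d - 2" using d by simp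
  then have "(-1)^1 * (deriv ^^ 1) \<psi> x \<ge> 0"
    using generator_d_monotone(2) assms by blast
  then show ?thesis by simp
qed

text \<open>For \<open>d = 3\<close> this is the monotonicity condition on the derivative of top
  order \<open>d - 2 = 1\<close>; for larger \<open>d\<close> the second derivative exists and is
  nonnegative.\<close>

lemma generator_deriv_mono:
  assumes "0 < x" "x \<le> y"
  shows "deriv \<psi> x \<le> deriv \<psi> y"
proof (cases "d = 3")
  case True
  then have "antimono_on {0<..} (\<lambda>x. - deriv \<psi> x)"
    using gen unfolding generator_def d_monotone_def by simp
  then show ?thesis using assms by (auto simp: monotone_on_def)
next
  case False
  show ?thesis
  proof (rule DERIV_nonneg_imp_nondecreasing[OF assms(2)])
    fix z assume z: "x \<le> z" "z \<le> y"
    have "(deriv ^^ 1) \<psi> differentiable (at z)"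
      using generator_d_monotone(1)[of 1 z] d False z assms by simp
    then have "(deriv \<psi> has_real_derivative deriv (deriv \<psi>) z) (at z)"
      by (simp add: DERIV_deriv_iff_real_differentiable)
    moreover have "(-1)^2 * (deriv ^^ 2) \<psi> z \<ge> 0"
      using generator_d_monotone(2)[of 2 z] d False z assms by simp
    ultimately show "\<exists>D. (deriv \<psi> has_real_derivative D) (at z) \<and> 0 \<le> D"
      by (auto simp: numeral_2_eq_2)
  qed
qed

text \<open>As the derivative increases, a nonnegative value at \<open>x\<close> would make
  \<open>\<psi>\<close> nondecreasing from \<open>x\<close> on, and the limit 0 would force
  \<open>\<psi> x \<le> 0\<close>.\<close>

lemma generator_deriv_neg:
  assumes "x > 0" "\<psi> x > 0"
  shows "deriv \<psi> x < 0"
proof (rule ccontr)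
  assume "\<not> deriv \<psi> x < 0"
  then have nonneg: "0 \<le> deriv \<psi> y" if "x \<le> y" for y
    using generator_deriv_mono[of x y] assms that by simp
  have "\<psi> x \<le> \<psi> y" if "x \<le> y" for y
    by (rule DERIV_nonneg_imp_nondecreasing[OF that])
      (meson generator_has_deriv nonneg assms(1) less_le_trans)
  then have "\<psi> x \<le> 0"
    using eventually_mono[OF eventually_ge_at_top[of x]]
    by (intro tendsto_lowerbound[OF generator_lim]) auto
  then show False using assms by simp
qed

lemma generator_antimono:
  assumes "0 \<le> x" "x \<le> y"
  shows "\<psi> y \<le> \<psi> x"
proof (cases "x = y")
  case False
  then have "x < y" using assms by simp
  have "continuous_on {x..y} \<psi>" using assms by (auto intro: continuous_on_subset[OF generator_cont])
  moreover have "\<psi> differentiable (at z)" if "x < z" "z < y" for z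
    using generator_has_deriv[of z] that assms by (auto simp: real_differentiable_def)
  ultimately obtain l z where z: "x < z" "z < y" "DERIV \<psi> z :> l" "\<psi> y - \<psi> x = (y - x) * l"
    using MVT[OF \<open>x < y\<close>] by blast
  have "l = deriv \<psi> z" using DERIV_unique[OF z(3) generator_has_deriv] z assms by simp
  then have "(y - x) * l \<le> 0"
    using generator_deriv_nonpos[of z] z assms by (simp add: mult_nonneg_nonpos)
  then show ?thesis using z by simp
qed simp

text \<open>A generator may reach 0 at a finite argument and stay there, hence the positivity at
  \<open>x\<close>.\<close>

lemma generator_strict_antimono:
  assumes "0 \<le> x" "x < y" "0 < \<psi> x"
  shows "\<psi> y < \<psi> x"
proof (cases "\<psi> y > 0")
  case True
  show ?thesis
  proof (rule DERIV_neg_imp_decreasing_open[OF assms(2)])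
    fix z assume z: "x < z" "z < y"
    then have "\<psi> z > 0" using True generator_antimono[of z y] assms by auto
    then show "\<exists>D. (\<psi> has_real_derivative D) (at z) \<and> D < 0"
      using generator_has_deriv[of z] generator_deriv_neg[of z] z assms by auto
  qed (use assms in \<open>auto intro: continuous_on_subset[OF generator_cont]\<close>)
qed (use assms in auto)

text \<open>A real-valued inverse, convenient for calculus. Since \<open>enn2real\<close> sends
  infinity to 0, it is faithful only where \<open>gen_inv\<close> is finite, in particular for
  \<open>0 < u \<le> 1\<close>.\<close>

abbreviation "\<phi> u \<equiv> enn2real (gen_inv \<psi> u)"

lemma gen_inv_eq_ennreal:
  assumes "0 < u" "u \<le> 1"
  shows "gen_inv \<psi> u = ennreal (\<phi> u)" "\<psi> (\<phi> u) = u"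
  using gen_inv_attained[OF generator_cont generator_zero generator_lim assms]
  by (metis enn2real_ennreal)+

text \<open>Strict decrease makes \<open>\<psi>\<close> injective where it is positive, so the
  one-sided inverse is two-sided there.\<close>

lemma gen_inv_generator:
  assumes "0 \<le> s" "0 < \<psi> s"
  shows "\<phi> (\<psi> s) = s"
proof (rule ccontr)
  assume "\<phi> (\<psi> s) \<noteq> s"
  moreover have eq: "\<psi> (\<phi> (\<psi> s)) = \<psi> s"
    using gen_inv_eq_ennreal(2) generator_range assms by simp
  ultimately show False
    using generator_strict_antimono[of s "\<phi> (\<psi> s)"] generator_strict_antimono[of "\<phi> (\<psi> s)" s] assms
    by (cases "s < \<phi> (\<psi> s)") auto
qed

lemma gen_inv_pos:
  assumes "0 < u" "u < 1"
  shows "0 < \<phi> u"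
  using gen_inv_eq_ennreal(2)[of u] generator_zero assms enn2real_nonneg[of "gen_inv \<psi> u"]
  by (metis less_eq_real_def less_irrefl)

text \<open>The inverse of a continuous injection on the compact interval
  \<open>{0..\<phi> q}\<close> is continuous; \<open>q > 0\<close> keeps \<open>\<psi>\<close>
  positive on it.\<close>

lemma gen_inv_cont:
  assumes "0 < q" "q \<le> 1"
  shows "continuous_on {q..1} \<phi>"
proof -
  have "continuous_on (\<psi> ` {0..\<phi> q}) \<phi>"
  proof (rule continuous_on_inv)
    show "\<forall>x\<in>{0..\<phi> q}. \<phi> (\<psi> x) = x"
    proof
      fix x assume x: "x \<in> {0..\<phi> q}"
      then have "q \<le> \<psi> x" using generator_antimono[of x "\<phi> q"] gen_inv_eq_ennreal(2)[OF assms] by simp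
      then show "\<phi> (\<psi> x) = x" using gen_inv_generator[of x] x assms by simp
    qed
  qed (auto intro: continuous_on_subset[OF generator_cont])
  moreover have "{q..1} \<subseteq> \<psi> ` {0..\<phi> q}"
  proof
    fix u assume u: "u \<in> {q..1}"
    then have eq: "\<psi> (\<phi> u) = u" using gen_inv_eq_ennreal(2)[of u] assms by simp
    have "\<not> \<phi> q < \<phi> u"
      using generator_strict_antimono[of "\<phi> q" "\<phi> u"] gen_inv_eq_ennreal(2)[OF assms] eq u assms by auto
    then show "u \<in> \<psi> ` {0..\<phi> q}" using eq by (intro image_eqI[of _ _ "\<phi> u"]) auto
  qed
  ultimately show ?thesis by (rule continuous_on_subset)
qed

text \<open>The bound \<open>u < 1\<close> puts \<open>\<phi> u\<close> in the open half-line where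
  \<open>\<psi>\<close> is differentiable, and \<open>u > 0\<close> makes the derivative there
  nonzero.\<close>

lemma gen_inv_has_deriv:
  assumes u: "0 < u" "u < 1"
  shows "(\<phi> has_real_derivative inverse (deriv \<psi> (\<phi> u))) (at u)"
proof (rule DERIV_inverse_function)
  show "(\<psi> has_real_derivative deriv \<psi> (\<phi> u)) (at (\<phi> u))"
    using gen_inv_pos[OF u] by (rule generator_has_deriv)
  show "deriv \<psi> (\<phi> u) \<noteq> 0"
    using generator_deriv_neg[OF gen_inv_pos[OF u]] gen_inv_eq_ennreal(2)[of u] u by simp
  show "0 < u" "u < 1" by fact+
  show "\<psi> (\<phi> y) = y" if "0 < y" "y < 1" for y
    using gen_inv_eq_ennreal(2)[of y] that by simp
  have "continuous_on {u/2<..<1} \<phi>"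
    using gen_inv_cont[of "u/2"] u by (auto intro: continuous_on_subset)
  then show "isCont \<phi> u"
    by (rule continuous_on_interior) (use u in auto)
qed

subsection \<open>The composition of the inverse generator with the distribution function\<close>

context
  fixes A :: "real set" and T :: "real \<Rightarrow> (real \<Rightarrow> real) \<Rightarrow> real \<Rightarrow> real"
    and F :: "real \<Rightarrow> real" and x :: real
begin

text \<open>At interior points the derivatives within sets in \<open>V_fun\<close> are ordinary
  ones, so \<open>V\<close> becomes the chain-rule derivative of the composition of
  \<open>\<phi>\<close> with \<open>T\<close>.\<close>

lemma
  assumes u: "0 < T b F x" "T b F x < 1"
    and b: "b \<in> interior A" and D: "((\<lambda>c. T c F x) has_real_derivative D) (at b)"
  shows mem_V_domain: "b \<in> V_domain A T F \<psi> x"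
    and V_fun_eq: "V_fun A T F \<psi> b x = D / deriv \<psi> (\<phi> (T b F x))"
proof -
  define s where "s = \<phi> (T b F x)"
  have s: "s > 0" "\<psi> s > 0" "gen_inv \<psi> (T b F x) = ennreal s"
    unfolding s_def using gen_inv_pos[OF u] gen_inv_eq_ennreal[of "T b F x"] u by auto
  have at_s: "at s within {0..} = at s"
    using s by (intro at_within_interior) (simp add: interior_real_atLeast)
  have at_b: "at b within A = at b" using b by (rule at_within_interior)
  note ds = generator_has_deriv[OF s(1)]
  show "b \<in> V_domain A T F \<psi> x"
    unfolding V_domain_def using s ds generator_deriv_neg[OF s(1,2)] b interior_subset
    by (auto simp: at_s intro!: exI[of _ "deriv \<psi> s"])
  have "vector_derivative \<psi> (at s) = deriv \<psi> s"
    using ds by (intro vector_derivative_at) (simp add: has_real_derivative_iff_has_vector_derivative)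
  moreover have "vector_derivative (\<lambda>c. T c F x) (at b) = D"
    using D by (intro vector_derivative_at) (simp add: has_real_derivative_iff_has_vector_derivative)
  ultimately show "V_fun A T F \<psi> b x = D / deriv \<psi> (\<phi> (T b F x))"
    unfolding V_fun_def by (simp add: at_s at_b flip: s_def)
qed

text \<open>The endpoints stand for the extreme coordinates of \<open>\<alpha>\<close>, where
  positivity is known; \<open>T_pos\<close> extends it to the points between them.\<close>

context
  fixes a b :: real
  assumes sub: "{a..b} \<subseteq> A"
    and unit: "\<And>c. c \<in> A \<Longrightarrow> 0 \<le> T c F x \<and> T c F x \<le> 1"
    and diff: "\<And>c. c \<in> A \<Longrightarrow> (\<lambda>c. T c F x) differentiable (at c within A)"
    and V_mono: "mono_on (V_domain A T F \<psi> x) (\<lambda>c. V_fun A T F \<psi> c x)"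
    and pos_ends: "0 < T a F x" "0 < T b F x"
begin

lemma T_cont: "continuous_on {a..b} (\<lambda>c. T c F x)"
proof -
  have "(\<lambda>c. T c F x) differentiable_on A" using diff by (simp add: differentiable_on_def)
  then show ?thesis using differentiable_imp_continuous_on continuous_on_subset sub by blast
qed

lemma Ioo_interior: "a < c \<Longrightarrow> c < b \<Longrightarrow> c \<in> interior A"
  using interior_mono[OF sub] by auto

lemma T_diff_interior:
  assumes "a < c" "c < b"
  shows "(\<lambda>c. T c F x) differentiable (at c)"
proof -
  have "c \<in> interior A" by (rule Ioo_interior[OF assms])
  then show ?thesis using diff[of c] at_within_interior[of c A] interior_subset by auto
qed

text \<open>If \<open>T\<close> vanished between two points where it is positive, then \<open>V\<close> would be positive somewhere
  before the zero and negative somewhere after it.\<close>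
lemma T_pos:
  assumes z: "z \<in> {a..b}"
  shows "0 < T z F x"
proof (rule ccontr)
  assume "\<not> 0 < T z F x"
  then have z0: "T z F x = 0" using unit[of z] sub z by force
  obtain p D where p: "a < p" "p < z" "0 < T p F x" "T p F x < 1"
      "((\<lambda>c. T c F x) has_real_derivative D) (at p)" "D < 0"
    using decreasing_point_before_zero[of a z "\<lambda>c. T c F x"] T_diff_interior z z0 pos_ends
      continuous_on_subset[OF T_cont, of "{a..z}"] by auto
  obtain q E where q: "z < q" "q < b" "0 < T q F x" "T q F x < 1"
      "((\<lambda>c. T c F x) has_real_derivative E) (at q)" "E > 0"
    using increasing_point_after_zero[of z b "\<lambda>c. T c F x"] T_diff_interior z z0 pos_ends
      continuous_on_subset[OF T_cont, of "{z..b}"] by auto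
  have int: "p \<in> interior A" "q \<in> interior A" using Ioo_interior p q z by auto
  have "V_fun A T F \<psi> p x \<le> V_fun A T F \<psi> q x"
    using V_mono mem_V_domain[OF p(3,4) int(1) p(5)] mem_V_domain[OF q(3,4) int(2) q(5)] p q
    by (auto simp: mono_on_def)
  moreover have neg: "deriv \<psi> (\<phi> (T c F x)) < 0" if "0 < T c F x" "T c F x < 1" for c
    using generator_deriv_neg[OF gen_inv_pos[OF that]] gen_inv_eq_ennreal(2)[of "T c F x"] that
    by simp
  have "0 < V_fun A T F \<psi> p x"
    using V_fun_eq[OF p(3,4) int(1) p(5)] neg[OF p(3,4)] p by (simp add: divide_neg_neg)
  moreover have "V_fun A T F \<psi> q x < 0"
    using V_fun_eq[OF q(3,4) int(2) q(5)] neg[OF q(3,4)] q by (simp add: divide_pos_neg)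
  ultimately show False by simp
qed

text \<open>The convexity criterion applies with \<open>V_fun\<close> as derivative: where
  \<open>\<phi> (T c F x)\<close> is positive, \<open>T c F x\<close> lies strictly between 0 and
  1.\<close>

lemma convex_on_gen_inv_T: "convex_on {a..b} (\<lambda>c. \<phi> (T c F x))"
proof (cases "a \<le> b")
  case True
  \<comment> \<open>The minimum of \<open>T\<close> is positive by \<open>T_pos\<close>, so the
    values of \<open>T\<close> stay in an interval on which \<open>\<phi>\<close> is
    continuous.\<close>
  obtain m where m: "m \<in> {a..b}" "\<And>c. c \<in> {a..b} \<Longrightarrow> T m F x \<le> T c F x"
    using continuous_attains_inf[OF _ _ T_cont] True by auto
  have lt1: "T c F x < 1" if "c \<in> {a..b}" "0 < \<phi> (T c F x)" for c
  proof (rule ccontr)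
    assume "\<not> T c F x < 1"
    then have "T c F x = 1" using unit[of c] sub that by force
    then show False using that(2) gen_inv_generator[of 0] generator_zero by simp
  qed
  have der: "((\<lambda>c. \<phi> (T c F x)) has_real_derivative V_fun A T F \<psi> c x) (at c)"
      and dom: "c \<in> V_domain A T F \<psi> x"
    if c: "a < c" "c < b" "0 < \<phi> (T c F x)" for c
  proof -
    have u: "0 < T c F x" "T c F x < 1" using T_pos lt1 c by auto
    obtain D where D: "((\<lambda>c. T c F x) has_real_derivative D) (at c)"
      using T_diff_interior[OF c(1,2)] by (auto simp: real_differentiable_def)
    note int = Ioo_interior[OF c(1,2)]
    show "c \<in> V_domain A T F \<psi> x" by (rule mem_V_domain[OF u int D])
    show "((\<lambda>c. \<phi> (T c F x)) has_real_derivative V_fun A T F \<psi> c x) (at c)"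
      using DERIV_chain2[OF gen_inv_has_deriv[OF u] D]
      by (simp add: V_fun_eq[OF u int D] divide_inverse mult.commute)
  qed
  show ?thesis
  proof (rule convex_on_Icc_if_deriv_mono_where_pos)
    have "(\<lambda>c. T c F x) ` {a..b} \<subseteq> {T m F x..1}" using m unit sub by auto
    then show "continuous_on {a..b} (\<lambda>c. \<phi> (T c F x))"
      using gen_inv_cont[of "T m F x"] T_pos m unit[of m] sub
      by (intro continuous_on_compose2[OF _ T_cont]) auto
  qed (use der dom V_mono in \<open>auto simp: mono_on_def\<close>)
qed (simp add: convex_on_def)

end

end

end

subsection \<open>Comparison of maxima\<close>

lemma super_additive_sum:
  assumes "super_additive g" "finite I" "\<And>i. i \<in> I \<Longrightarrow> 0 \<le> s i"
  shows "(\<Sum>i\<in>I. g (s i)) \<le> g (\<Sum>i\<in>I. s i)"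
  using assms(2,3)
proof (induction I rule: finite_induct)
  case (insert i I)
  then have "(\<Sum>i\<in>insert i I. g (s i)) \<le> g (s i) + g (\<Sum>i\<in>I. s i)"
    by (simp add: add_left_mono)
  also have "\<dots> \<le> g (s i + (\<Sum>i\<in>I. s i))"
  proof -
    have "0 \<le> s i" "0 \<le> (\<Sum>i\<in>I. s i)" using insert.prems by (auto intro: sum_nonneg)
    then show ?thesis using assms(1) by (simp add: super_additive_def)
  qed
  finally show ?case using insert.hyps by simp
qed simp

text \<open>Super-additivity gives \<open>R \<le> \<phi> \<psi>\<^sub>2 w\<close> for the left-hand
  side \<open>w\<close>. Applying the decreasing \<open>\<psi>\<^sub>2\<close> yields
  \<open>w \<le> \<psi>\<^sub>2 R\<close>, and \<open>R' \<le> R\<close> does the rest.\<close>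

lemma gen_ext_sum_le:
  fixes u v :: "nat \<Rightarrow> real"
  assumes \<psi>\<^sub>1: "generator d\<^sub>1 \<psi>\<^sub>1" and \<psi>\<^sub>2: "generator d \<psi>\<^sub>2" and d: "d \<ge> 3"
    and super: "super_additive (gen_inv \<psi>\<^sub>2 \<circ> \<psi>\<^sub>1)"
    and u: "\<And>i. i \<in> {1..n} \<Longrightarrow> 0 < u i \<and> u i \<le> 1"
    and v: "\<And>i. i \<in> {1..n} \<Longrightarrow> 0 < v i \<and> v i \<le> 1"
    and le: "(\<Sum>i=1..n. \<phi> \<psi>\<^sub>2 (v i)) \<le> (\<Sum>i=1..n. \<phi> \<psi>\<^sub>2 (u i))"
  shows "gen_ext \<psi>\<^sub>1 (\<Sum>i=1..n. gen_inv \<psi>\<^sub>1 (u i)) \<le> gen_ext \<psi>\<^sub>2 (\<Sum>i=1..n. gen_inv \<psi>\<^sub>2 (v i))"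
proof -
  have g1: "continuous_on {0..} \<psi>\<^sub>1" "\<psi>\<^sub>1 0 = 1" "(\<psi>\<^sub>1 \<longlongrightarrow> 0) at_top"
      "\<And>x. 0 \<le> x \<Longrightarrow> \<psi>\<^sub>1 x \<le> 1"
    using \<psi>\<^sub>1 unfolding generator_def by auto
  define s where "s i = enn2real (gen_inv \<psi>\<^sub>1 (u i))" for i
  have s: "0 \<le> s i" "gen_inv \<psi>\<^sub>1 (u i) = ennreal (s i)" "\<psi>\<^sub>1 (s i) = u i" if i: "i \<in> {1..n}" for i
    using gen_inv_attained[OF g1(1-3), of "u i"] u[OF i] unfolding s_def
    by (metis enn2real_ennreal enn2real_nonneg)+
  define w where "w = \<psi>\<^sub>1 (\<Sum>i=1..n. s i)"
  define R where "R = (\<Sum>i=1..n. \<phi> \<psi>\<^sub>2 (u i))"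
  define R' where "R' = (\<Sum>i=1..n. \<phi> \<psi>\<^sub>2 (v i))"
  have sum_s: "0 \<le> (\<Sum>i=1..n. s i)" using s by (intro sum_nonneg) auto
  have R: "0 \<le> R" "0 \<le> R'" "R' \<le> R" using le by (auto simp: R_def R'_def intro: sum_nonneg)
  have lhs: "gen_ext \<psi>\<^sub>1 (\<Sum>i=1..n. gen_inv \<psi>\<^sub>1 (u i)) = w"
  proof -
    have "(\<Sum>i=1..n. gen_inv \<psi>\<^sub>1 (u i)) = ennreal (\<Sum>i=1..n. s i)"
      using s by (subst sum_ennreal[symmetric]) auto
    then show ?thesis using sum_s by (simp add: gen_ext_def w_def)
  qed
  have to_real: "(\<Sum>i=1..n. gen_inv \<psi>\<^sub>2 (y i)) = ennreal (\<Sum>i=1..n. \<phi> \<psi>\<^sub>2 (y i))"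
    if "\<And>i. i \<in> {1..n} \<Longrightarrow> 0 < y i \<and> y i \<le> 1" for y :: "nat \<Rightarrow> real"
    using gen_inv_eq_ennreal(1)[OF \<psi>\<^sub>2 d] that by (subst sum_ennreal[symmetric]) auto
  have rhs: "gen_ext \<psi>\<^sub>2 (\<Sum>i=1..n. gen_inv \<psi>\<^sub>2 (v i)) = \<psi>\<^sub>2 R'"
    using to_real[OF v] R by (simp add: gen_ext_def R'_def)
  \<comment> \<open>The case \<open>w = 0\<close> is separate because the inverse of
    \<open>\<psi>\<^sub>2\<close> may be infinite there.\<close>
  have "w \<le> \<psi>\<^sub>2 R'"
  proof (cases "w > 0")
    case True
    have w1: "w \<le> 1" unfolding w_def using g1(4) sum_s by simp
    have "ennreal R = (\<Sum>i=1..n. (gen_inv \<psi>\<^sub>2 \<circ> \<psi>\<^sub>1) (s i))"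
      using to_real[OF u] s by (simp add: R_def)
    also have "\<dots> \<le> (gen_inv \<psi>\<^sub>2 \<circ> \<psi>\<^sub>1) (\<Sum>i=1..n. s i)"
      by (rule super_additive_sum[OF super]) (use s in auto)
    also have "\<dots> = ennreal (\<phi> \<psi>\<^sub>2 w)"
      using gen_inv_eq_ennreal(1)[OF \<psi>\<^sub>2 d True w1] by (simp add: w_def)
    finally have "R \<le> \<phi> \<psi>\<^sub>2 w" by (simp add: ennreal_le_iff)
    then have "\<psi>\<^sub>2 (\<phi> \<psi>\<^sub>2 w) \<le> \<psi>\<^sub>2 R'" using generator_antimono[OF \<psi>\<^sub>2 d] R by simp
    then show ?thesis using gen_inv_eq_ennreal(2)[OF \<psi>\<^sub>2 d True w1] by simp
  next
    case False
    then show ?thesis using generator_range(1)[OF \<psi>\<^sub>2 d R(2)] by simp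
  qed
  then show ?thesis unfolding lhs rhs .
qed

section \<open>Distributions of maxima and the main comparison\<close>

lemma cdfs_unit:
  assumes "G \<in> cdfs"
  shows "0 \<le> G x \<and> G x \<le> 1"
proof -
  obtain M where M: "G = cdf M" "real_distribution M" using assms by (auto simp: cdfs_def)
  then interpret real_distribution M by simp
  show ?thesis using M cdf_nonneg cdf_bounded_prob by simp
qed

context
  fixes n :: nat and M :: "'a measure" and X :: "nat \<Rightarrow> 'a \<Rightarrow> real"
  assumes X: "random_vector n M X"
begin

lemma random_vector_sets: "{\<omega> \<in> space M. \<forall>i\<in>{1..n}. X i \<omega> \<le> x} \<in> sets M"
proof (intro sets.sets_Collect_finite_All)
  fix i assume "i \<in> {1..n}"
  then have [measurable]: "X i \<in> borel_measurable M" using X by (simp add: random_vector_def)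
  show "{\<omega> \<in> space M. X i \<omega> \<le> x} \<in> sets M" by measurable
qed simp

text \<open>Passing to complements turns the stochastic order of maxima into the reverse comparison
  of joint distribution functions on the diagonal.\<close>

lemma measure_max_stat_gt:
  assumes "n \<ge> 1"
  shows "measure M {\<omega> \<in> space M. max_stat n X \<omega> > x}
    = 1 - measure M {\<omega> \<in> space M. \<forall>i\<in>{1..n}. X i \<omega> \<le> x}"
proof -
  interpret prob_space M using X by (simp add: random_vector_def)
  have "{\<omega> \<in> space M. max_stat n X \<omega> > x} = space M - {\<omega> \<in> space M. \<forall>i\<in>{1..n}. X i \<omega> \<le> x}"
    using assms by (auto simp: max_stat_def Max_gr_iff not_le)
  then show ?thesis using prob_compl[OF random_vector_sets] by simp
qed

text \<open>This settles points where a marginal of \<open>X\<close> vanishes, without evaluating an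
  inverse generator at 0.\<close>

lemma measure_le_marginal:
  assumes i: "i \<in> {1..n}"
  shows "measure M {\<omega> \<in> space M. \<forall>i\<in>{1..n}. X i \<omega> \<le> x} \<le> cdf (distr M borel (X i)) x"
proof -
  interpret prob_space M using X by (simp add: random_vector_def)
  have Xi: "X i \<in> borel_measurable M" using X i by (simp add: random_vector_def)
  have "measure M {\<omega> \<in> space M. \<forall>i\<in>{1..n}. X i \<omega> \<le> x} \<le> measure M (X i -` {..x} \<inter> space M)"
    using i Xi by (intro finite_measure_mono) auto
  then show ?thesis using Xi by (simp add: cdf_def measure_distr)
qed

lemma measure_archimedean:
  assumes C: "archimedean n C \<psi>" "has_copula n M X C"
    and marg: "\<And>i. i \<in> {1..n} \<Longrightarrow> cdf (distr M borel (X i)) = G i" "\<And>i. i \<in> {1..n} \<Longrightarrow> G i \<in> cdfs"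
  shows "measure M {\<omega> \<in> space M. \<forall>i\<in>{1..n}. X i \<omega> \<le> x}
    = gen_ext \<psi> (\<Sum>i=1..n. gen_inv \<psi> (G i x))"
proof -
  let ?v = "\<lambda>i. cdf (distr M borel (X i)) x"
  have "measure M {\<omega> \<in> space M. \<forall>i\<in>{1..n}. X i \<omega> \<le> x} = C ?v"
    using C(2) unfolding has_copula_def by (rule allE[of _ "\<lambda>_. x"]) simp
  also have "\<dots> = gen_ext \<psi> (\<Sum>i=1..n. gen_inv \<psi> (?v i))"
    using C(1) marg cdfs_unit unfolding archimedean_def by auto
  also have "(\<Sum>i=1..n. gen_inv \<psi> (?v i)) = (\<Sum>i=1..n. gen_inv \<psi> (G i x))"
    using marg by (intro sum.cong) auto
  finally show ?thesis .
qed

end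

text \<open>The assumption \<open>is_interval A\<close> places the segment between the extreme
  coordinates of \<open>\<alpha>\<close> inside \<open>A\<close>, so that \<open>V\<close> can be
  used along it.\<close>

theorem theorem3p3:
  fixes A :: "real set"
    and T :: "real \<Rightarrow> (real \<Rightarrow> real) \<Rightarrow> real \<Rightarrow> real"
    and F :: "real \<Rightarrow> real"
    and n d d\<^sub>1 :: nat
    and \<alpha> \<beta> :: "nat \<Rightarrow> real"
    and M :: "'a measure" and N :: "'b measure"
    and X :: "nat \<Rightarrow> 'a \<Rightarrow> real" and Y :: "nat \<Rightarrow> 'b \<Rightarrow> real"
    and \<psi>\<^sub>1 \<psi>\<^sub>2 :: "real \<Rightarrow> real"
    and C\<^sub>1 C\<^sub>2 :: "(nat \<Rightarrow> real) \<Rightarrow> real"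
  assumes n: "n \<ge> 1"
    and A: "is_interval A"
    and T: "\<And>a G. a \<in> A \<Longrightarrow> G \<in> cdfs \<Longrightarrow> T a G \<in> cdfs"
    and F: "F \<in> cdfs"
    and \<alpha>: "\<And>i. i \<in> {1..n} \<Longrightarrow> \<alpha> i \<in> A"
    and \<beta>: "\<And>i. i \<in> {1..n} \<Longrightarrow> \<beta> i \<in> A"
    and \<psi>\<^sub>1: "generator d\<^sub>1 \<psi>\<^sub>1"
    and \<psi>\<^sub>2: "generator d \<psi>\<^sub>2" and d: "d \<ge> 3"
    and X: "random_vector n M X"
    and X_marg: "\<And>i. i \<in> {1..n} \<Longrightarrow> cdf (distr M borel (X i)) = T (\<alpha> i) F"
    and X_cop: "archimedean n C\<^sub>1 \<psi>\<^sub>1" "has_copula n M X C\<^sub>1"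
    and Y: "random_vector n N Y"
    and Y_marg: "\<And>i. i \<in> {1..n} \<Longrightarrow> cdf (distr N borel (Y i)) = T (\<beta> i) F"
    and Y_cop: "archimedean n C\<^sub>2 \<psi>\<^sub>2" "has_copula n N Y C\<^sub>2"
    and T_diff: "\<And>G b x. G \<in> cdfs \<Longrightarrow> b \<in> A \<Longrightarrow> (\<lambda>c. T c G x) differentiable (at b within A)"
    and super: "super_additive (gen_inv \<psi>\<^sub>2 \<circ> \<psi>\<^sub>1)"
    and maj: "majorizes n \<alpha> \<beta>"
    and V_mono: "\<And>x. mono_on (V_domain A T F \<psi>\<^sub>2 x) (\<lambda>b. V_fun A T F \<psi>\<^sub>2 b x)"
  shows "st_le N (max_stat n Y) M (max_stat n X)"
proof -
  have "measure M {\<omega> \<in> space M. \<forall>i\<in>{1..n}. X i \<omega> \<le> x}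
      \<le> measure N {\<omega> \<in> space N. \<forall>i\<in>{1..n}. Y i \<omega> \<le> x}" for x
  proof (cases "\<exists>i\<in>{1..n}. T (\<alpha> i) F x = 0")
    case True
    then obtain i where "i \<in> {1..n}" "T (\<alpha> i) F x = 0" by blast
    then have "measure M {\<omega> \<in> space M. \<forall>i\<in>{1..n}. X i \<omega> \<le> x} \<le> 0"
      using measure_le_marginal[OF X, of i x] X_marg[of i] by simp
    then show ?thesis using measure_nonneg order_trans by blast
  next
    case False
    have unit: "0 \<le> T c F x \<and> T c F x \<le> 1" if "c \<in> A" for c
      using cdfs_unit[OF T[OF that F]] by blast
    have \<alpha>_pos: "0 < T (\<alpha> i) F x" if "i \<in> {1..n}" for i
      using False unit[OF \<alpha>[OF that]] that by force
    define a b where "a = incr_coord n \<alpha> 1" and "b = incr_coord n \<alpha> n"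
    have "a \<in> \<alpha> ` {1..n}" "b \<in> \<alpha> ` {1..n}"
      using incr_coord_in_image[of 0 n \<alpha>] incr_coord_in_image[of "n - 1" n \<alpha>] n
      by (auto simp: a_def b_def)
    then have ends: "a \<in> A" "b \<in> A" "0 < T a F x" "0 < T b F x" using \<alpha> \<alpha>_pos by auto
    have sub: "{a..b} \<subseteq> A"
      using A ends(1,2) unfolding is_interval_1 by (meson atLeastAtMost_iff subsetI)
    note hull = sub unit T_diff[OF F] V_mono ends(3,4)
    have \<beta>_hull: "\<beta> i \<in> {a..b}" if i: "i \<in> {1..n}" for i
    proof -
      obtain j where "j < n" "\<beta> i = incr_coord n \<beta> (Suc j)"
        using coord_is_incr_coord[OF i] by blast
      then show ?thesis using majorizes_hull[OF maj] unfolding a_def b_def by simp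
    qed
    \<comment> \<open>The marginals of \<open>Y\<close> cannot vanish at \<open>x\<close> either, so
      all inverses in the comparison are finite.\<close>
    have \<beta>_pos: "0 < T (\<beta> i) F x" if "i \<in> {1..n}" for i
      by (rule T_pos[where T = T and F = F, OF \<psi>\<^sub>2 d hull \<beta>_hull[OF that]])
    have "convex_on {a..b} (\<lambda>c. \<phi> \<psi>\<^sub>2 (T c F x))"
      by (rule convex_on_gen_inv_T[where T = T and F = F, OF \<psi>\<^sub>2 d hull])
    then have "(\<Sum>i=1..n. \<phi> \<psi>\<^sub>2 (T (\<beta> i) F x)) \<le> (\<Sum>i=1..n. \<phi> \<psi>\<^sub>2 (T (\<alpha> i) F x))"
      using karamata_majorizes[OF maj] unfolding a_def b_def by blast
    then have "gen_ext \<psi>\<^sub>1 (\<Sum>i=1..n. gen_inv \<psi>\<^sub>1 (T (\<alpha> i) F x))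
        \<le> gen_ext \<psi>\<^sub>2 (\<Sum>i=1..n. gen_inv \<psi>\<^sub>2 (T (\<beta> i) F x))"
      using \<alpha>_pos \<beta>_pos \<alpha> \<beta> unit by (intro gen_ext_sum_le[OF \<psi>\<^sub>1 \<psi>\<^sub>2 d super]) auto
    then show ?thesis
      using measure_archimedean[OF X X_cop X_marg] measure_archimedean[OF Y Y_cop Y_marg]
        T[OF \<alpha> F] T[OF \<beta> F] by simp
  qed
  then show ?thesis
    unfolding st_le_def measure_max_stat_gt[OF X n] measure_max_stat_gt[OF Y n] by simp
qed

end
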